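(* Let $A$ be a perfect evolution $\mathbb{K}$-algebra with natural basis $B$ and associated directed graph $E$ relative to $B$. Let $I$ be a maximal ideal of $A$. Then there exists a maximal hereditary subset $H\subset E^0$ such that $I=I_H$. Furthermore, $H=H_I$ and $I$ is a basic ideal.
   Context: An evolution algebra over a field $\mathbb{K}$ is a (not necessarily associative or finite-dimensional) $\mathbb{K}$-algebra $A$ having a basis $B=\{e_i\}_{i\in\Lambda}$, called a natural basis, with $e_ie_j=0$ whenever $i\neq j$. $A$ is perfect if $A^2=A$, where $A^2$ is the linear span of all products. The associated directed graph $E$ relative to $B$ has vertex set $E^0=B$ and exactly one edge from $e_i$ to $e_j$ if the coefficient of $e_j$ in $e_i^2$ is nonzero, and no edge otherwise. A subset $H\subset E^0$ is hereditary if, for every $u\in H$, every vertex reachable from $u$ by a directed path belongs to $H$. A hereditary set $H\neq E^0$ is maximal if whenever $H\subset H'$ with $H'$ hereditary, then $H'=H$ or $H'=E^0$. For an ideal $I$ of $A$, $H_I:=\{e_i\in B: e_i^2\in I\}$. For a hereditary $H$, $I_H:=\operatorname{span}(H)$, with $I_\emptyset=\{0\}$. An ideal $I$ of $A$ is basic if it admits a natural basis that can be extended to a natural basis of $A$. *)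

theory Defs
  imports Main "Graph_Theory.Pair_Digraph"
begin

locale nonassoc_algebra = vector_space scale
  for scale :: "'k::field \<Rightarrow> 'a::ab_group_add \<Rightarrow> 'a" +
  fixes mult :: "'a \<Rightarrow> 'a \<Rightarrow> 'a" (infixl "\<cdot>" 70)
  assumes mult_linear_right: "Vector_Spaces.linear scale scale (\<lambda>y. x \<cdot> y)"
    and mult_linear_left: "Vector_Spaces.linear scale scale (\<lambda>x. x \<cdot> y)"
begin

text \<open>The set \<open>S\<close> is the carrier of the (sub)algebra of which \<open>C\<close> is a natural basis;
  the case \<open>S = UNIV\<close> is that of the whole algebra.\<close>

definition natural_basis_of :: "'a set \<Rightarrow> 'a set \<Rightarrow> bool" where
  "natural_basis_of S C \<longleftrightarrow>
     independent C \<and> span C = S \<and> (\<forall>x\<in>C. \<forall>y\<in>C. x \<noteq> y \<longrightarrow> x \<cdot> y = 0)"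

definition perfect :: bool where
  "perfect \<longleftrightarrow> span {x \<cdot> y |x y. True} = UNIV"

definition is_ideal :: "'a set \<Rightarrow> bool" where
  "is_ideal I \<longleftrightarrow> subspace I \<and> (\<forall>x\<in>I. \<forall>a. a \<cdot> x \<in> I \<and> x \<cdot> a \<in> I)"

definition maximal_ideal :: "'a set \<Rightarrow> bool" where
  "maximal_ideal I \<longleftrightarrow> is_ideal I \<and> I \<noteq> UNIV \<and>
     (\<forall>J. is_ideal J \<and> I \<subseteq> J \<longrightarrow> J = I \<or> J = UNIV)"

definition basic_ideal :: "'a set \<Rightarrow> bool" where
  "basic_ideal I \<longleftrightarrow> is_ideal I \<and>
     (\<exists>C. natural_basis_of I C \<and> (\<exists>D. C \<subseteq> D \<and> natural_basis_of UNIV D))"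

end

locale evolution_algebra = nonassoc_algebra scale mult
  for scale :: "'k::field \<Rightarrow> 'a::ab_group_add \<Rightarrow> 'a"
    and mult :: "'a \<Rightarrow> 'a \<Rightarrow> 'a" (infixl "\<cdot>" 70) +
  fixes B :: "'a set"
  assumes natural_basis: "natural_basis_of UNIV B"
begin

definition associated_graph :: "'a pair_pre_digraph" where
  "associated_graph =
     \<lparr> pverts = B, parcs = {(u, v). u \<in> B \<and> v \<in> B \<and> representation B (u \<cdot> u) v \<noteq> 0} \<rparr>"

text \<open>The set \<open>H\<^sub>I\<close>.\<close>

definition H_of_ideal :: "'a set \<Rightarrow> 'a set" where
  "H_of_ideal I = {u \<in> B. u \<cdot> u \<in> I}"

end

definition hereditary :: "('v, 'e) pre_digraph \<Rightarrow> 'v set \<Rightarrow> bool" where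
  "hereditary G H \<longleftrightarrow> H \<subseteq> verts G \<and> (\<forall>u\<in>H. \<forall>v. u \<rightarrow>\<^sup>*\<^bsub>G\<^esub> v \<longrightarrow> v \<in> H)"

definition maximal_hereditary :: "('v, 'e) pre_digraph \<Rightarrow> 'v set \<Rightarrow> bool" where
  "maximal_hereditary G H \<longleftrightarrow> hereditary G H \<and> H \<noteq> verts G \<and>
     (\<forall>H'. hereditary G H' \<and> H \<subseteq> H' \<longrightarrow> H' = H \<or> H' = verts G)"

end

theory Submission
  imports Defs
begin

text \<open>
  Multiplying \<open>x\<close> by a natural basis vector \<open>e\<close> isolates one coefficient: \<open>e x\<close> is the coefficient
  of \<open>e\<close> in \<open>x\<close> times \<open>e\<^sup>2\<close>. Hence the support of every element of an ideal \<open>I\<close> lies in \<open>H\<^sub>I\<close>, that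
  is, \<open>I \<subseteq> span H\<^sub>I\<close>. By the definition of \<open>H\<^sub>I\<close>, the squares of its elements lie in \<open>I\<close>, hence in
  \<open>span H\<^sub>I\<close>, and this alone makes \<open>span H\<^sub>I\<close> an ideal. So a maximal \<open>I\<close> equals \<open>span H\<^sub>I\<close> unless
  \<open>H\<^sub>I\<close> is the whole basis. In that case all squares of basis vectors would lie in \<open>I\<close>, hence all
  products, and \<open>I\<close> would be the whole algebra because the algebra is perfect.

  The rest is the correspondence between hereditary sets of vertices and ideals spanned by basis
  vectors (\<open>is_ideal_span_iff_hereditary\<close>): it preserves and reflects inclusion, since a subset of
  a basis is recovered from its span, and so it turns the maximality of \<open>I\<close> into that of \<open>H\<^sub>I\<close>.
  The set \<open>H\<^sub>I\<close> is itself a natural basis of \<open>I\<close> contained in \<open>B\<close>, so \<open>I\<close> is basic.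
\<close>

lemma (in wf_digraph) hereditary_iff_closed_under_arcs:
  "hereditary G H \<longleftrightarrow>
     H \<subseteq> verts G \<and> (\<forall>u\<in>H. \<forall>v. u \<rightarrow>\<^bsub>G\<^esub> v \<longrightarrow> v \<in> H)"
proof
  assume "hereditary G H"
  then show "H \<subseteq> verts G \<and> (\<forall>u\<in>H. \<forall>v. u \<rightarrow>\<^bsub>G\<^esub> v \<longrightarrow> v \<in> H)"
    unfolding hereditary_def by (blast intro: reachable_adjI)
next
  assume closed: "H \<subseteq> verts G \<and> (\<forall>u\<in>H. \<forall>v. u \<rightarrow>\<^bsub>G\<^esub> v \<longrightarrow> v \<in> H)"
  have "v \<in> H" if "u \<rightarrow>\<^sup>*\<^bsub>G\<^esub> v" "u \<in> H" for u v
    using that by (induction rule: reachable_induct) (use closed in blast)+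
  with closed show "hereditary G H"
    unfolding hereditary_def by blast
qed

context vector_space
begin

lemma mem_span_subset_basis_iff:
  assumes "independent B" "span B = UNIV" "H \<subseteq> B"
  shows "x \<in> span H \<longleftrightarrow> (\<forall>b\<in>B. representation B x b \<noteq> 0 \<longrightarrow> b \<in> H)"
proof
  assume x: "x \<in> span H"
  have "representation B x = representation H x"
    using representation_extend[OF assms(1) x assms(3)] .
  then show "\<forall>b\<in>B. representation B x b \<noteq> 0 \<longrightarrow> b \<in> H"
    using representation_ne_zero by metis
next
  assume supp: "\<forall>b\<in>B. representation B x b \<noteq> 0 \<longrightarrow> b \<in> H"
  have "(\<Sum>b | representation B x b \<noteq> 0. representation B x b *s b) \<in> span H"
    by (intro span_sum span_scale span_base) (use supp representation_ne_zero in blast)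
  then show "x \<in> span H"
    using assms by (simp add: sum_nonzero_representation_eq)
qed

lemma span_subset_basis_inject:
  assumes "independent B" "H \<subseteq> B" "K \<subseteq> B" "span H = span K"
  shows "H = K"
proof -
  have "H' \<subseteq> K'" if sub: "H' \<subseteq> B" "K' \<subseteq> B" and eq: "span H' = span K'" for H' K'
  proof
    fix b assume b: "b \<in> H'"
    show "b \<in> K'"
    proof (rule ccontr)
      assume "b \<notin> K'"
      then have "span K' \<subseteq> span (B - {b})"
        using sub by (intro span_mono) blast
      then have "b \<in> span (B - {b})"
        using b eq span_base by blast
      then show False
        using assms(1) b sub unfolding dependent_def by blast
    qed
  qed
  then show ?thesis
    using assms by (metis subset_antisym)
qed

end

context nonassoc_algebra
begin

lemma subspace_left_mult_vimage:
  assumes "subspace S"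
  shows "subspace {x. a \<cdot> x \<in> S}"
proof -
  interpret L: Vector_Spaces.linear scale scale "\<lambda>x. a \<cdot> x"
    by (rule mult_linear_right)
  show ?thesis
    using L.subspace_vimage[OF assms] by (simp add: vimage_def)
qed

lemma subspace_right_mult_vimage:
  assumes "subspace S"
  shows "subspace {x. x \<cdot> a \<in> S}"
proof -
  interpret L: Vector_Spaces.linear scale scale "\<lambda>x. x \<cdot> a"
    by (rule mult_linear_left)
  show ?thesis
    using L.subspace_vimage[OF assms] by (simp add: vimage_def)
qed

text \<open>By bilinearity, whether a subspace absorbs products needs checking on spanning sets only. Both
  halves of the ideal property, and the inclusion of all products, are obtained in this way.\<close>

lemma mult_span_mem:
  assumes "subspace S" "\<And>a b. a \<in> X \<Longrightarrow> b \<in> Y \<Longrightarrow> a \<cdot> b \<in> S"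
    and "x \<in> span X" "y \<in> span Y"
  shows "x \<cdot> y \<in> S"
proof -
  have "x \<cdot> b \<in> S" if "b \<in> Y" for b
    using span_minimal[OF _ subspace_right_mult_vimage[OF assms(1)]] assms(2,3) that by blast
  then show ?thesis
    using span_minimal[OF _ subspace_left_mult_vimage[OF assms(1)]] assms(4) by blast
qed

end

context evolution_algebra
begin

lemma independent_basis: "independent B"
  and span_basis: "span B = UNIV"
  and basis_orthogonal: "x \<in> B \<Longrightarrow> y \<in> B \<Longrightarrow> x \<noteq> y \<Longrightarrow> x \<cdot> y = 0"
  using natural_basis unfolding natural_basis_of_def by auto

lemma basis_mult_eq_scale_square:
  assumes "e \<in> B"
  shows "e \<cdot> x = scale (representation B x e) (e \<cdot> e)"
proof -
  interpret L: Vector_Spaces.linear scale scale "\<lambda>y. e \<cdot> y"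
    by (rule mult_linear_right)
  let ?r = "representation B x" and ?supp = "{b. representation B x b \<noteq> 0}"
  have "e \<cdot> x = e \<cdot> (\<Sum>b\<in>?supp. scale (?r b) b)"
    using independent_basis span_basis by (simp add: sum_nonzero_representation_eq)
  also have "\<dots> = (\<Sum>b\<in>?supp. scale (?r b) (e \<cdot> b))"
    by (simp add: L.sum L.scale)
  also have "\<dots> = (\<Sum>b\<in>?supp. if b = e then scale (?r e) (e \<cdot> e) else 0)"
    by (intro sum.cong) (auto simp: basis_orthogonal assms dest: representation_ne_zero)
  also have "\<dots> = scale (?r e) (e \<cdot> e)"
    by (simp add: finite_representation)
  finally show ?thesis .
qed

text \<open>Since distinct basis vectors annihilate each other, the only products \<open>b h\<close> or \<open>h b\<close> with
  \<open>b \<in> B\<close> and \<open>h \<in> H\<close> that can leave \<open>span H\<close> are the squares of the elements of \<open>H\<close>.\<close>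

lemma is_ideal_span_iff_squares:
  assumes "H \<subseteq> B"
  shows "is_ideal (span H) \<longleftrightarrow> (\<forall>u\<in>H. u \<cdot> u \<in> span H)"
proof
  assume "is_ideal (span H)"
  then show "\<forall>u\<in>H. u \<cdot> u \<in> span H"
    unfolding is_ideal_def by (blast intro: span_base)
next
  assume sq: "\<forall>u\<in>H. u \<cdot> u \<in> span H"
  have prod: "b \<cdot> h \<in> span H \<and> h \<cdot> b \<in> span H" if "b \<in> B" "h \<in> H" for b h
    using that assms sq basis_orthogonal by (cases "b = h") (auto simp: span_zero subset_iff)
  have "a \<cdot> x \<in> span H \<and> x \<cdot> a \<in> span H" if "x \<in> span H" for a x
  proof
    show "a \<cdot> x \<in> span H"
      by (rule mult_span_mem[of _ B H]) (use that prod span_basis in auto)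
    show "x \<cdot> a \<in> span H"
      by (rule mult_span_mem[of _ H B]) (use that prod span_basis in auto)
  qed
  then show "is_ideal (span H)"
    unfolding is_ideal_def by auto
qed

lemma wf_digraph_associated_graph: "wf_digraph (with_proj associated_graph)"
  by unfold_locales (auto simp: associated_graph_def)

text \<open>An arc from \<open>u\<close> to \<open>v\<close> means that \<open>v\<close> is in the support of \<open>u\<^sup>2\<close>, so closure of \<open>H\<close> under arcs
  says that the squares of its elements lie in \<open>span H\<close>.\<close>

lemma is_ideal_span_iff_hereditary:
  assumes "H \<subseteq> B"
  shows "is_ideal (span H) \<longleftrightarrow> hereditary (with_proj associated_graph) H"
proof -
  interpret wf_digraph "with_proj associated_graph"
    by (rule wf_digraph_associated_graph)
  have "hereditary (with_proj associated_graph) H \<longleftrightarrow>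
      (\<forall>u\<in>H. \<forall>v\<in>B. representation B (u \<cdot> u) v \<noteq> 0 \<longrightarrow> v \<in> H)"
    unfolding hereditary_iff_closed_under_arcs
    using assms by (auto simp: associated_graph_def)
  also have "\<dots> \<longleftrightarrow> (\<forall>u\<in>H. u \<cdot> u \<in> span H)"
    using mem_span_subset_basis_iff[OF independent_basis span_basis assms] by blast
  finally show ?thesis
    using is_ideal_span_iff_squares[OF assms] by blast
qed

lemma H_of_ideal_subset: "H_of_ideal I \<subseteq> B"
  unfolding H_of_ideal_def by blast

text \<open>If \<open>e\<close> is in the support of \<open>x \<in> I\<close>, then \<open>e x \<in> I\<close> is a nonzero multiple of \<open>e\<^sup>2\<close>.\<close>

lemma ideal_subset_span_H_of_ideal:
  assumes "is_ideal I"
  shows "I \<subseteq> span (H_of_ideal I)"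
proof
  fix x assume "x \<in> I"
  have "e \<cdot> e \<in> I" if e: "e \<in> B" and nz: "representation B x e \<noteq> 0" for e
  proof -
    let ?c = "representation B x e"
    have "scale ?c (e \<cdot> e) \<in> I"
      using assms \<open>x \<in> I\<close> basis_mult_eq_scale_square[OF e, of x] unfolding is_ideal_def by metis
    then have "scale (inverse ?c) (scale ?c (e \<cdot> e)) \<in> I"
      using assms unfolding is_ideal_def by (blast intro: subspace_scale)
    then show ?thesis
      using nz by simp
  qed
  then show "x \<in> span (H_of_ideal I)"
    using mem_span_subset_basis_iff[OF independent_basis span_basis H_of_ideal_subset]
    by (auto simp: H_of_ideal_def)
qed

lemma is_ideal_span_H_of_ideal:
  assumes "is_ideal I"
  shows "is_ideal (span (H_of_ideal I))"
  using is_ideal_span_iff_squares[OF H_of_ideal_subset] ideal_subset_span_H_of_ideal[OF assms]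
  unfolding H_of_ideal_def by blast

text \<open>If \<open>H\<^sub>I\<close> is the whole basis then \<open>I\<close> contains all products, so it contains \<open>A\<^sup>2 = A\<close>.\<close>

lemma H_of_ideal_neq_basis:
  assumes "perfect" "is_ideal I" "I \<noteq> UNIV"
  shows "H_of_ideal I \<noteq> B"
proof
  assume all: "H_of_ideal I = B"
  have sub: "subspace I"
    using assms unfolding is_ideal_def by blast
  have "a \<cdot> b \<in> I" if "a \<in> B" "b \<in> B" for a b
    using all that basis_orthogonal subspace_0[OF sub]
    by (cases "a = b") (auto simp: H_of_ideal_def)
  then have "x \<cdot> y \<in> I" for x y
    using mult_span_mem[OF sub, of B B x y] span_basis by blast
  then have "span {x \<cdot> y |x y. True} \<subseteq> I"
    by (intro span_minimal sub) blast
  then show False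
    using assms unfolding perfect_def by blast
qed

lemma maximal_ideal_eq_span_H_of_ideal:
  assumes "perfect" "maximal_ideal I"
  shows "I = span (H_of_ideal I)"
proof -
  have I: "is_ideal I" "I \<noteq> UNIV"
    using assms unfolding maximal_ideal_def by auto
  have "span (H_of_ideal I) \<noteq> UNIV"
    using span_subset_basis_inject[OF independent_basis H_of_ideal_subset order_refl]
      H_of_ideal_neq_basis[OF assms(1) I] span_basis by auto
  then show ?thesis
    using assms(2) is_ideal_span_H_of_ideal[OF I(1)] ideal_subset_span_H_of_ideal[OF I(1)]
    unfolding maximal_ideal_def by blast
qed

lemma maximal_hereditary_if_maximal_ideal_span:
  assumes "H \<subseteq> B" "maximal_ideal (span H)"
  shows "maximal_hereditary (with_proj associated_graph) H"
proof -
  have verts: "verts (with_proj associated_graph) = B"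
    by (simp add: associated_graph_def)
  have "hereditary (with_proj associated_graph) H"
    using assms is_ideal_span_iff_hereditary unfolding maximal_ideal_def by blast
  moreover have "H \<noteq> B"
    using assms(2) span_basis unfolding maximal_ideal_def by blast
  moreover have "H' = H \<or> H' = B"
    if her: "hereditary (with_proj associated_graph) H'" and "H \<subseteq> H'" for H'
  proof -
    have "H' \<subseteq> B"
      using her verts unfolding hereditary_def by blast
    then have "is_ideal (span H')"
      using her is_ideal_span_iff_hereditary by blast
    then have "span H' = span H \<or> span H' = span B"
      using assms(2) span_mono[OF \<open>H \<subseteq> H'\<close>] span_basis unfolding maximal_ideal_def by blast
    then show ?thesis
      using span_subset_basis_inject[OF independent_basis \<open>H' \<subseteq> B\<close>] assms(1) by blast
  qed
  ultimately show ?thesis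
    unfolding maximal_hereditary_def verts by blast
qed

lemma basic_ideal_span:
  assumes "H \<subseteq> B" "is_ideal (span H)"
  shows "basic_ideal (span H)"
proof -
  have "natural_basis_of (span H) H"
    using independent_mono[OF independent_basis assms(1)] assms(1) basis_orthogonal
    unfolding natural_basis_of_def by blast
  then show ?thesis
    using assms natural_basis unfolding basic_ideal_def by blast
qed

end

theorem corollary3p11:
  fixes scale :: "'k::field \<Rightarrow> 'a::ab_group_add \<Rightarrow> 'a"
    and mult :: "'a \<Rightarrow> 'a \<Rightarrow> 'a"
    and B I :: "'a set"
  assumes "evolution_algebra scale mult B"
    and "nonassoc_algebra.perfect scale mult"
    and "nonassoc_algebra.maximal_ideal scale mult I"
  shows "(\<exists>H. maximal_hereditary (with_proj (evolution_algebra.associated_graph scale mult B)) H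
            \<and> I = module.span scale H
            \<and> H = evolution_algebra.H_of_ideal mult B I)
         \<and> nonassoc_algebra.basic_ideal scale mult I"
proof -
  interpret evolution_algebra scale mult B
    by (rule assms(1))
  have I: "I = span (H_of_ideal I)"
    by (rule maximal_ideal_eq_span_H_of_ideal[OF assms(2,3)])
  have "maximal_hereditary (with_proj associated_graph) (H_of_ideal I)"
    using maximal_hereditary_if_maximal_ideal_span[OF H_of_ideal_subset] I assms(3) by metis
  moreover have "basic_ideal I"
    using basic_ideal_span[OF H_of_ideal_subset] I assms(3) unfolding maximal_ideal_def by metis
  ultimately show ?thesis
    using I by blast
qed

end
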